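(* Let $(X,\tau)$ be a topological space, let $\varphi_1,\varphi_2\in O(X,\tau)$, and let $A\subset X$. If $\varphi_1$ is monotonous and $\varphi_2(U\cup V)=\varphi_2(U)\cup\varphi_2(V)$ for each pair $U,V\in\varphi_1O(X)$, then the following are equivalent: (a) $A$ is a $\varphi_{1,2}$-compact set. (b) Each filterbase $\mathcal{F}_b$ which is a subfamily of $\{X\setminus\varphi_2(U):U\in\varphi_1O(X)\}$ and meets $A$ $\varphi_{1,2}$-accumulates to some point $a\in A$.
   Context: Let $(X,\tau)$ be a topological space and let $A^{o}$ denote the interior of $A\subset X$. An operation on $(X,\tau)$ is a map $\varphi:P(X)\to P(X)$ with $A^{o}\subset\varphi(A)$ for all $A\in P(X)$ and $\varphi(\emptyset)=\emptyset$; $O(X,\tau)$ is the set of all operations. $\varphi$ is monotonous if $A\subset B$ implies $\varphi(A)\subset\varphi(B)$. A set $A\subset X$ is $\varphi$-open if $A\subset\varphi(A)$; $\varphi O(X)$ is the family of all $\varphi$-open sets. For $A\subset X$: $x\in\varphi_{1,2}\mathrm{cl}\,A$ iff $\varphi_2(U)\cap A\neq\emptyset$ for every $U\in\varphi_1O(X)$ with $x\in U$. A set $A\subset X$ is a $\varphi_{1,2}$-compact set (relative to $X$) if every family $\mathcal{U}\subset\varphi_1O(X)$ with $A\subset\bigcup\mathcal{U}$ has a finite subfamily $\mathcal{U}'$ with $A\subset\bigcup\{\varphi_2(U):U\in\mathcal{U}'\}$. A filterbase is a nonempty family of nonempty subsets of $X$ such that the intersection of any two members contains a member. A filterbase $\mathcal{F}_b$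 meets $A$ if $F\cap A\neq\emptyset$ for every $F\in\mathcal{F}_b$; it $\varphi_{1,2}$-accumulates to $a$ if $a\in\bigcap\{\varphi_{1,2}\mathrm{cl}\,F:F\in\mathcal{F}_b\}$. *)

theory Defs
  imports "HOL-Analysis.Abstract_Topology"
begin

text \<open>
  The space \<open>(X, \<tau>)\<close> is a value of type \<open>'a topology\<close> with carrier \<open>topspace X\<close>. An operation
  is a HOL function on \<open>'a set\<close>; only its values on subsets of the carrier matter, and every
  definition below applies it only to such sets.
\<close>

definition operation :: "'a topology \<Rightarrow> ('a set \<Rightarrow> 'a set) \<Rightarrow> bool" where
  "operation X \<phi> \<longleftrightarrow>
     \<phi> \<in> Pow (topspace X) \<rightarrow> Pow (topspace X) \<and>
     (\<forall>A. A \<subseteq> topspace X \<longrightarrow> X interior_of A \<subseteq> \<phi> A) \<and>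
     \<phi> {} = {}"

definition monotonous :: "'a topology \<Rightarrow> ('a set \<Rightarrow> 'a set) \<Rightarrow> bool" where
  "monotonous X \<phi> \<longleftrightarrow> mono_on (Pow (topspace X)) \<phi>"

definition op_open_sets :: "'a topology \<Rightarrow> ('a set \<Rightarrow> 'a set) \<Rightarrow> 'a set set" where
  "op_open_sets X \<phi> = {A. A \<subseteq> topspace X \<and> A \<subseteq> \<phi> A}"

definition op_closure ::
  "'a topology \<Rightarrow> ('a set \<Rightarrow> 'a set) \<Rightarrow> ('a set \<Rightarrow> 'a set) \<Rightarrow> 'a set \<Rightarrow> 'a set" where
  "op_closure X \<phi>1 \<phi>2 A =
     {x \<in> topspace X. \<forall>U \<in> op_open_sets X \<phi>1. x \<in> U \<longrightarrow> \<phi>2 U \<inter> A \<noteq> {}}"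

definition op_compact ::
  "'a topology \<Rightarrow> ('a set \<Rightarrow> 'a set) \<Rightarrow> ('a set \<Rightarrow> 'a set) \<Rightarrow> 'a set \<Rightarrow> bool" where
  "op_compact X \<phi>1 \<phi>2 A \<longleftrightarrow>
     A \<subseteq> topspace X \<and>
     (\<forall>\<U>. \<U> \<subseteq> op_open_sets X \<phi>1 \<and> A \<subseteq> \<Union>\<U> \<longrightarrow>
        (\<exists>\<U>'. finite \<U>' \<and> \<U>' \<subseteq> \<U> \<and> A \<subseteq> (\<Union>U\<in>\<U>'. \<phi>2 U)))"

definition filterbase :: "'a topology \<Rightarrow> 'a set set \<Rightarrow> bool" where
  "filterbase X \<F> \<longleftrightarrow>
     \<F> \<noteq> {} \<and>
     (\<forall>F\<in>\<F>. F \<subseteq> topspace X \<and> F \<noteq> {}) \<and>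
     (\<forall>F\<in>\<F>. \<forall>G\<in>\<F>. \<exists>H\<in>\<F>. H \<subseteq> F \<inter> G)"

definition meets :: "'a set set \<Rightarrow> 'a set \<Rightarrow> bool" where
  "meets \<F> A \<longleftrightarrow> (\<forall>F\<in>\<F>. F \<inter> A \<noteq> {})"

definition accumulates_to ::
  "'a topology \<Rightarrow> ('a set \<Rightarrow> 'a set) \<Rightarrow> ('a set \<Rightarrow> 'a set) \<Rightarrow> 'a set set \<Rightarrow> 'a \<Rightarrow> bool" where
  "accumulates_to X \<phi>1 \<phi>2 \<F> a \<longleftrightarrow> a \<in> (\<Inter>F\<in>\<F>. op_closure X \<phi>1 \<phi>2 F)"

end

theory Submission
  imports Defs
begin

text \<open>
  If a filterbase meeting \<open>A\<close> accumulates nowhere in \<open>A\<close>, then the \<open>\<phi>1\<close>-open sets \<open>U\<close> whose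
  enlargement \<open>\<phi>2 U\<close> misses some member cover \<open>A\<close>; a finite subcover yields a member disjoint
  from \<open>A\<close>. Conversely, if a cover \<open>\<U>\<close> admits no finite subfamily whose enlargements cover \<open>A\<close>,
  the complements of the sets \<open>\<phi>2 (\<Union>\<U>')\<close> with \<open>\<U>' \<subseteq> \<U>\<close> finite form a filterbase: monotonicity
  of \<open>\<phi>1\<close> keeps the unions \<open>\<phi>1\<close>-open, and additivity of \<open>\<phi>2\<close> makes the complements closed under
  intersection. It cannot accumulate at a point of any \<open>U \<in> \<U>\<close>, since it contains the complement
  of \<open>\<phi>2 U\<close>.
\<close>

text \<open>Each member satisfies
  \<open>U \<subseteq> \<phi> U \<subseteq> \<phi> (\<Union>\<U>)\<close>, the second inclusion by
  monotonicity.\<close>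

lemma op_open_sets_Union:
  assumes "monotonous X \<phi>" and "\<U> \<subseteq> op_open_sets X \<phi>"
  shows "\<Union>\<U> \<in> op_open_sets X \<phi>"
proof -
  have sub: "\<Union>\<U> \<subseteq> topspace X"
    using assms(2) by (auto simp: op_open_sets_def)
  have "U \<subseteq> \<phi> (\<Union>\<U>)" if "U \<in> \<U>" for U
  proof -
    have "U \<subseteq> \<phi> U" "U \<subseteq> topspace X"
      using assms(2) that by (auto simp: op_open_sets_def)
    moreover have "\<phi> U \<subseteq> \<phi> (\<Union>\<U>)"
      using assms(1) sub that unfolding monotonous_def
      by (intro mono_onD[of "Pow (topspace X)" \<phi>]) auto
    ultimately show ?thesis by blast
  qed
  with sub show ?thesis by (auto simp: op_open_sets_def)
qed

text \<open>Additivity is assumed only for pairs of \<open>\<phi>1\<close>-open sets, so the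
  induction step must know that the union of the remaining sets is \<open>\<phi>1\<close>-open; this
  is where monotonicity enters.\<close>

lemma finite_Union_additive:
  assumes "monotonous X \<phi>1" and "\<phi>2 {} = {}"
    and add: "\<And>U V. U \<in> op_open_sets X \<phi>1 \<Longrightarrow> V \<in> op_open_sets X \<phi>1 \<Longrightarrow>
      \<phi>2 (U \<union> V) = \<phi>2 U \<union> \<phi>2 V"
    and "finite \<U>" and "\<U> \<subseteq> op_open_sets X \<phi>1"
  shows "\<phi>2 (\<Union>\<U>) = (\<Union>U\<in>\<U>. \<phi>2 U)"
  using assms(4,5)
proof (induction \<U> rule: finite_induct)
  case empty
  then show ?case using assms(2) by simp
next
  case (insert U \<U>)
  then have "\<Union>\<U> \<in> op_open_sets X \<phi>1"
    using op_open_sets_Union[OF assms(1)] by simp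
  then show ?case using insert add[of U "\<Union>\<U>"] by simp
qed

lemma filterbase_finite_Inter:
  assumes "filterbase X \<F>" and "finite \<G>" and "\<G> \<subseteq> \<F>"
  obtains H where "H \<in> \<F>" and "H \<subseteq> \<Inter>\<G>"
proof -
  have "\<exists>H\<in>\<F>. H \<subseteq> \<Inter>\<G>"
    using assms(2,3)
  proof (induction \<G> rule: finite_induct)
    case empty
    then show ?case using assms(1) by (auto simp: filterbase_def)
  next
    case (insert F \<G>)
    then obtain H where H: "H \<in> \<F>" "H \<subseteq> \<Inter>\<G>" by auto
    moreover have "F \<in> \<F>" using insert.prems by simp
    ultimately obtain K where "K \<in> \<F>" "K \<subseteq> F \<inter> H"
      using assms(1) unfolding filterbase_def by meson
    with H(2) show ?case by auto
  qed
  with that show thesis by blast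
qed

lemma op_compact_imp_accumulates:
  assumes compact: "op_compact X \<phi>1 \<phi>2 A" and fb: "filterbase X \<F>" and "meets \<F> A"
  obtains a where "a \<in> A" and "accumulates_to X \<phi>1 \<phi>2 \<F> a"
proof (rule ccontr)
  assume "\<not> thesis"
  with that have none: "\<not> accumulates_to X \<phi>1 \<phi>2 \<F> a" if "a \<in> A" for a
    using \<open>a \<in> A\<close> by blast
  define \<U> where "\<U> = {U \<in> op_open_sets X \<phi>1. \<exists>F\<in>\<F>. \<phi>2 U \<inter> F = {}}"
  \<comment> \<open>\<open>op_closure\<close> is confined to the carrier, so a point outside it
    yields a separating \<open>U\<close> only once the point is known to lie in the carrier.\<close>
  have "A \<subseteq> topspace X"
    using compact by (simp add: op_compact_def)
  then have "A \<subseteq> \<Union>\<U>"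
    using none unfolding \<U>_def accumulates_to_def op_closure_def by blast
  moreover have "\<U> \<subseteq> op_open_sets X \<phi>1"
    by (auto simp: \<U>_def)
  ultimately obtain \<U>' where \<U>': "finite \<U>'" "\<U>' \<subseteq> \<U>" "A \<subseteq> (\<Union>U\<in>\<U>'. \<phi>2 U)"
    using compact unfolding op_compact_def by meson
  have "\<forall>U\<in>\<U>'. \<exists>F\<in>\<F>. \<phi>2 U \<inter> F = {}"
    using \<U>'(2) by (auto simp: \<U>_def)
  then obtain f where f: "\<And>U. U \<in> \<U>' \<Longrightarrow> f U \<in> \<F> \<and> \<phi>2 U \<inter> f U = {}"
    by metis
  \<comment> \<open>Some member \<open>H\<close> lies below all the chosen \<open>f U\<close>. A
    point of \<open>H\<close> in \<open>A\<close> is covered by some \<open>\<phi>2 U\<close>, yet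
    lies in \<open>f U\<close>, which is disjoint from it.\<close>
  obtain H where H: "H \<in> \<F>" "H \<subseteq> \<Inter>(f ` \<U>')"
    using filterbase_finite_Inter[OF fb, of "f ` \<U>'"] \<U>'(1) f by blast
  then obtain x where x: "x \<in> H" "x \<in> A"
    using \<open>meets \<F> A\<close> unfolding meets_def by blast
  then obtain U where U: "U \<in> \<U>'" "x \<in> \<phi>2 U"
    using \<U>'(3) by blast
  then have "x \<in> f U"
    using H(2) x(1) by blast
  with f[OF U(1)] U(2) show False by blast
qed

lemma accumulates_imp_op_compact:
  assumes "A \<subseteq> topspace X" and mono: "monotonous X \<phi>1" and empty: "\<phi>2 {} = {}"
    and add: "\<And>U V. U \<in> op_open_sets X \<phi>1 \<Longrightarrow> V \<in> op_open_sets X \<phi>1 \<Longrightarrow>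
      \<phi>2 (U \<union> V) = \<phi>2 U \<union> \<phi>2 V"
    and acc: "\<And>\<F>. filterbase X \<F> \<Longrightarrow>
      \<F> \<subseteq> {topspace X - \<phi>2 U | U. U \<in> op_open_sets X \<phi>1} \<Longrightarrow> meets \<F> A \<Longrightarrow>
      \<exists>a\<in>A. accumulates_to X \<phi>1 \<phi>2 \<F> a"
  shows "op_compact X \<phi>1 \<phi>2 A"
  unfolding op_compact_def
proof (intro conjI allI impI, fact assms(1), elim conjE, rule ccontr)
  fix \<U> assume \<U>: "\<U> \<subseteq> op_open_sets X \<phi>1" and cover: "A \<subseteq> \<Union>\<U>"
    and "\<nexists>\<U>'. finite \<U>' \<and> \<U>' \<subseteq> \<U> \<and> A \<subseteq> (\<Union>U\<in>\<U>'. \<phi>2 U)"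
  then have no_cover: "\<not> A \<subseteq> (\<Union>U\<in>\<V>. \<phi>2 U)" if "finite \<V>" "\<V> \<subseteq> \<U>" for \<V>
    using that by blast
  \<comment> \<open>Writing \<open>\<phi>2 (\<Union>\<V>)\<close> gives the members the shape that
    \<open>acc\<close> demands; \<open>C_eq\<close> turns this into a union of enlargements, for
    which intersections are easy to compute.\<close>
  define C where "C \<V> = topspace X - \<phi>2 (\<Union>\<V>)" for \<V>
  define \<F> where "\<F> = C ` {\<V>. finite \<V> \<and> \<V> \<subseteq> \<U>}"
  have C_eq: "C \<V> = topspace X - (\<Union>U\<in>\<V>. \<phi>2 U)" if "finite \<V>" "\<V> \<subseteq> \<U>" for \<V>
    unfolding C_def using finite_Union_additive[where ?\<phi>2.0 = \<phi>2, OF mono empty add] that \<U> by simp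
  have C_meets: "C \<V> \<inter> A \<noteq> {}" if "finite \<V>" "\<V> \<subseteq> \<U>" for \<V>
    using no_cover[OF that] assms(1) unfolding C_eq[OF that] by blast
  then have meets: "meets \<F> A"
    unfolding meets_def \<F>_def by blast
  have C_Un: "C (\<V> \<union> \<W>) = C \<V> \<inter> C \<W>"
    if "finite \<V>" "\<V> \<subseteq> \<U>" "finite \<W>" "\<W> \<subseteq> \<U>" for \<V> \<W>
    using that C_eq[of "\<V> \<union> \<W>"] C_eq[of \<V>] C_eq[of \<W>] by auto
  have "filterbase X \<F>"
    unfolding filterbase_def
  proof (intro conjI ballI)
    show "\<F> \<noteq> {}" unfolding \<F>_def by blast
  next
    fix F assume "F \<in> \<F>"
    then show "F \<subseteq> topspace X" by (auto simp: \<F>_def C_def)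
    \<comment> \<open>Members are nonempty because they even meet \<open>A\<close>.\<close>
    show "F \<noteq> {}" using meets \<open>F \<in> \<F>\<close> by (auto simp: meets_def)
  next
    fix F G assume "F \<in> \<F>" "G \<in> \<F>"
    then obtain \<V> \<W> where "finite \<V>" "\<V> \<subseteq> \<U>" "F = C \<V>" "finite \<W>" "\<W> \<subseteq> \<U>" "G = C \<W>"
      unfolding \<F>_def by blast
    then have "F \<inter> G \<in> \<F>"
      unfolding \<F>_def using C_Un by (intro image_eqI[of _ _ "\<V> \<union> \<W>"]) auto
    then show "\<exists>H\<in>\<F>. H \<subseteq> F \<inter> G" by blast
  qed
  moreover have "\<F> \<subseteq> {topspace X - \<phi>2 U | U. U \<in> op_open_sets X \<phi>1}"
    unfolding \<F>_def C_def using op_open_sets_Union[OF mono] \<U> by blast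
  ultimately obtain a where a: "a \<in> A" "accumulates_to X \<phi>1 \<phi>2 \<F> a"
    using acc meets by blast
  then obtain U where U: "U \<in> \<U>" "a \<in> U" using cover by blast
  \<comment> \<open>The singleton subfamily gives the complement of \<open>\<phi>2 U\<close> itself,
    so accumulation at \<open>a\<close> would force \<open>\<phi>2 U\<close> to meet its own
    complement.\<close>
  then have "C {U} \<in> \<F>" by (auto simp: \<F>_def)
  with a(2) U \<U> have "\<phi>2 U \<inter> C {U} \<noteq> {}"
    unfolding accumulates_to_def op_closure_def by blast
  then show False by (auto simp: C_def)
qed

theorem theorem3p11:
  fixes X :: "'a topology" and \<phi>1 \<phi>2 :: "'a set \<Rightarrow> 'a set" and A :: "'a set"
  assumes "operation X \<phi>1" and "operation X \<phi>2"
    and "A \<subseteq> topspace X"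
    and "monotonous X \<phi>1"
    and "\<And>U V. U \<in> op_open_sets X \<phi>1 \<Longrightarrow> V \<in> op_open_sets X \<phi>1 \<Longrightarrow> \<phi>2 (U \<union> V) = \<phi>2 U \<union> \<phi>2 V"
  shows "op_compact X \<phi>1 \<phi>2 A \<longleftrightarrow>
    (\<forall>\<F>. filterbase X \<F> \<and> \<F> \<subseteq> {topspace X - \<phi>2 U | U. U \<in> op_open_sets X \<phi>1} \<and> meets \<F> A \<longrightarrow>
       (\<exists>a\<in>A. accumulates_to X \<phi>1 \<phi>2 \<F> a))"
    (is "_ \<longleftrightarrow> ?acc")
proof
  assume "op_compact X \<phi>1 \<phi>2 A"
  then show ?acc
    using op_compact_imp_accumulates[of X \<phi>1 \<phi>2 A] by metis
next
  assume acc: ?acc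
  have "\<phi>2 {} = {}"
    using assms(2) by (simp add: operation_def)
  show "op_compact X \<phi>1 \<phi>2 A"
    by (rule accumulates_imp_op_compact[where ?\<phi>2.0 = \<phi>2, OF assms(3,4) \<open>\<phi>2 {} = {}\<close> assms(5)])
      (use acc in auto)
qed

end
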